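(* Let $(X,d)$ be an indecomposable semicontinuum with more than one point. Then there is a sequence of pairwise disjoint continua $K_0,K_1,K_2,\ldots\subsetneq X$ such that $K_n\to X$ in the Vietoris topology. In particular, $d(x,K_n)\to 0$ as $n\to\infty$ for each $x\in X$.
   Context: All spaces are separable and metrizable; $d$ is a metric inducing the topology of $X$. A continuum is a compact connected metrizable space with more than one point. A semicontinuum is a continuum-wise connected space, i.e. a space $X$ such that every two points of $X$ lie in a continuum contained in $X$. An indecomposable semicontinuum is a semicontinuum which cannot be written as the union of two proper closed connected subsets. For a space $X$, $2^X$ denotes the set of non-empty closed subsets of $X$. A sequence $(A_n)$ in $2^X$ converges to $X$ in the Vietoris topology if for every finite collection of non-empty open sets $U_1,\ldots,U_k\subset X$ there exists $N$ such that for all $n\geq N$ we have $A_n\cap U_i\neq\varnothing$ for each $i\leq k$. For $x \in X$ and non-empty $A\subset X$, $d(x,A)=\inf_{a\in A}d(x,a)$. *)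

theory Defs
  imports "HOL-Analysis.Analysis"
begin

text \<open>
  A metric space \<open>(X, d)\<close> is a set \<open>X\<close> in a type of class \<open>metric_space\<close>, with \<open>d\<close> the restriction
  of \<open>dist\<close>. The ambient type plays no role: open and closed subsets of \<open>X\<close> are always taken
  relative to \<open>X\<close>, and \<open>compact\<close> and \<open>connected\<close> do not depend on the ambient space.
\<close>

definition nondegenerate :: "'a set \<Rightarrow> bool" where
  "nondegenerate X \<longleftrightarrow> (\<exists>x\<in>X. \<exists>y\<in>X. x \<noteq> y)"

definition continuum :: "'a::metric_space set \<Rightarrow> bool" where
  "continuum K \<longleftrightarrow> compact K \<and> connected K \<and> nondegenerate K"

text \<open>
  Continua have more than one point, so the two points below are required to be distinct;
  for a set with more than one point this restriction makes no difference.
\<close>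

definition semicontinuum :: "'a::metric_space set \<Rightarrow> bool" where
  "semicontinuum X \<longleftrightarrow>
    (\<forall>x\<in>X. \<forall>y\<in>X. x \<noteq> y \<longrightarrow> (\<exists>K. continuum K \<and> K \<subseteq> X \<and> x \<in> K \<and> y \<in> K))"

definition indecomposable_semicontinuum :: "'a::metric_space set \<Rightarrow> bool" where
  "indecomposable_semicontinuum X \<longleftrightarrow>
    semicontinuum X \<and>
    \<not> (\<exists>A B. closedin (top_of_set X) A \<and> connected A \<and> A \<subset> X \<and>
             closedin (top_of_set X) B \<and> connected B \<and> B \<subset> X \<and>
             X = A \<union> B)"

definition hyperspace :: "'a::metric_space set \<Rightarrow> 'a set set" where
  "hyperspace X = {A. closedin (top_of_set X) A \<and> A \<noteq> {}}"

text \<open>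
  Convergence to the whole space \<open>X\<close> only. Basic Vietoris neighbourhoods of \<open>X\<close> are given by
  finitely many open sets that have to be met and a cover of \<open>X\<close>; the covering condition
  is void here, since every \<open>A n\<close> is a subset of \<open>X\<close>.
\<close>

definition vietoris_converges_to_space :: "(nat \<Rightarrow> 'a::metric_space set) \<Rightarrow> 'a set \<Rightarrow> bool" where
  "vietoris_converges_to_space A X \<longleftrightarrow>
    (\<forall>n. A n \<in> hyperspace X) \<and>
    (\<forall>\<U>. finite \<U> \<and> (\<forall>U\<in>\<U>. openin (top_of_set X) U \<and> U \<noteq> {}) \<longrightarrow>
         (\<exists>N. \<forall>n\<ge>N. \<forall>U\<in>\<U>. A n \<inter> U \<noteq> {}))"

end

theory Submission
  imports Defs
begin

text \<open>
  The heart of the proof is the following fact. Let \<open>L\<close> be a proper continuum in an indecomposable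
  semicontinuum \<open>Y\<close>; then for any finitely many non-empty open sets there is a continuum in
  \<open>Y - L\<close> that meets all of them (\<open>continuum_in_complement_meeting_opens\<close>). Call the union of all
  continua in \<open>Y - L\<close> through a point, the point itself included, its continuum component. By boundary bumping every continuum
  component accumulates at \<open>L\<close>, so \<open>L\<close> together with any collection of continuum components is
  connected. If the components meeting \<open>U\<^sub>1, \<dots>, U\<^sub>k\<close> have, together with \<open>L\<close>, a dense union,
  split them into those that meet a further open set \<open>U\<close> and those that do not. By
  indecomposability one of the two parts is, together with \<open>L\<close>, dense. It is not the second one,
  which misses \<open>U - L\<close>, a non-empty set because \<open>L\<close> has empty interior. So the first one is dense,
  and by induction some component meets all of the prescribed open sets.

  Given this, choose the continua recursively, keeping a proper continuum \<open>L\<^sub>n\<close> that contains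
  \<open>K\<^sub>0, \<dots>, K\<^sub>n\<close>, and pick \<open>K\<^bsub>n+1\<^esub>\<close> in the complement of \<open>L\<^sub>n\<close> meeting the first members
  of a countable family of open sets that is fine enough to test Vietoris convergence
  (\<open>disjoint_continua_meeting_opens\<close>). To enlarge \<open>L\<^sub>n\<close> one joins it to
  \<open>K\<^bsub>n+1\<^esub>\<close> by a continuum, which must be proper. If \<open>X\<close> is compact, two points need not lie
  in a common proper continuum. The construction therefore takes place in a composant of \<open>X\<close>,
  where they do: it is dense in \<open>X\<close>, again by boundary bumping, and inherits indecomposability.
\<close>

section \<open>Indecomposability in terms of density\<close>

text \<open>
  Two connected sets with dense union cannot both fail to be dense. In this form indecomposability
  applies to sets that are not closed, such as unions of continuum components, and passes to dense
  subsets. Closures are taken in the ambient space and compared with \<open>Y\<close>.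
\<close>

definition dense_indecomposable :: "'a::metric_space set \<Rightarrow> bool" where
  "dense_indecomposable Y \<longleftrightarrow>
    (\<forall>A B. A \<subseteq> Y \<and> B \<subseteq> Y \<and> connected A \<and> connected B \<and> Y \<subseteq> closure (A \<union> B)
       \<longrightarrow> Y \<subseteq> closure A \<or> Y \<subseteq> closure B)"

text \<open>
  The relative closures of two connected sets with dense union would otherwise be a forbidden
  decomposition.
\<close>

lemma indecomposable_semicontinuum_imp_dense_indecomposable:
  assumes "indecomposable_semicontinuum X"
  shows "dense_indecomposable X"
  unfolding dense_indecomposable_def
proof (intro allI impI, elim conjE)
  fix A B assume AB: "A \<subseteq> X" "B \<subseteq> X" "connected A" "connected B" "X \<subseteq> closure (A \<union> B)"
  have conn: "connected (X \<inter> closure C)" if "connected C" "C \<subseteq> X" for C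
    by (rule connected_intermediate_closure[OF that(1)]) (use that closure_subset in auto)
  have clo: "closedin (top_of_set X) (X \<inter> closure C)" for C
    by (simp add: closedin_closed_Int)
  have "X = (X \<inter> closure A) \<union> (X \<inter> closure B)"
    using AB(5) by auto
  then have "\<not> (X \<inter> closure A \<subset> X \<and> X \<inter> closure B \<subset> X)"
    using assms conn[OF AB(3,1)] conn[OF AB(4,2)] clo
    unfolding indecomposable_semicontinuum_def by metis
  then show "X \<subseteq> closure A \<or> X \<subseteq> closure B" by blast
qed

lemma dense_indecomposable_dense_subset:
  assumes "dense_indecomposable X" "Y \<subseteq> X" "X \<subseteq> closure Y"
  shows "dense_indecomposable Y"
  unfolding dense_indecomposable_def
proof (intro allI impI, elim conjE)
  fix A B assume AB: "A \<subseteq> Y" "B \<subseteq> Y" "connected A" "connected B" "Y \<subseteq> closure (A \<union> B)"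
  have "X \<subseteq> closure (A \<union> B)"
    using AB(5) assms(3) closure_minimal by blast
  then have "X \<subseteq> closure A \<or> X \<subseteq> closure B"
    using assms AB unfolding dense_indecomposable_def by (meson order_trans)
  then show "Y \<subseteq> closure A \<or> Y \<subseteq> closure B"
    using assms(2) by blast
qed

lemma dense_indecomposable_closed_Un:
  assumes "dense_indecomposable Y" "A \<subseteq> Y" "B \<subseteq> Y" "connected A" "connected B"
    and "closed A" "closed B" "A \<noteq> Y" "B \<noteq> Y"
  shows "A \<union> B \<noteq> Y"
proof
  assume "A \<union> B = Y"
  then have "Y \<subseteq> closure (A \<union> B)" by (simp add: closure_subset)
  then have "Y \<subseteq> closure A \<or> Y \<subseteq> closure B"
    using assms(1-5) unfolding dense_indecomposable_def by blast
  then show False using assms by auto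
qed

text \<open>
  Proper closed connected subsets have empty interior. If \<open>Y - L\<close> is connected, it is one of two
  connected sets, the other being \<open>L\<close>, that cover \<open>Y\<close>. If it splits into two clopen pieces, adding
  \<open>L\<close> to either piece gives a connected closed proper subset, and these two subsets cover \<open>Y\<close>.
\<close>

lemma dense_indecomposable_dense_complement:
  assumes ind: "dense_indecomposable Y" and "connected Y"
    and L: "L \<subseteq> Y" "closed L" "connected L" "L \<noteq> Y"
  shows "Y \<subseteq> closure (Y - L)"
proof (cases "connected (Y - L)")
  case True
  have "Y \<subseteq> closure (L \<union> (Y - L))"
    using L(1) closure_subset[of "L \<union> (Y - L)"] by blast
  then have "Y \<subseteq> closure L \<or> Y \<subseteq> closure (Y - L)"
    using ind L True unfolding dense_indecomposable_def by blast
  then show ?thesis using L by auto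
next
  case False
  then obtain A B where AB: "closedin (top_of_set (Y - L)) A" "closedin (top_of_set (Y - L)) B"
      "A \<union> B = Y - L" "A \<inter> B = {}" "A \<noteq> {}" "B \<noteq> {}"
    unfolding connected_closedin_eq by blast
  have eq: "A = (Y - L) - B" "B = (Y - L) - A" using AB by auto
  have op: "openin (top_of_set (Y - L)) A" "openin (top_of_set (Y - L)) B"
    by (metis AB(2) eq(1) openin_diff openin_subtopology_self)
       (metis AB(1) eq(2) openin_diff openin_subtopology_self)
  have cA: "connected (L \<union> A)" and cB: "connected (L \<union> B)"
    using connected_Un_clopen_in_complement[OF L(3) \<open>connected Y\<close> L(1)] op AB by blast+
  have "closedin (top_of_set Y) L" by (simp add: L closed_subset)
  then have opY: "openin (top_of_set Y) (Y - L)" by (simp add: openin_diff)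
  have miss: "\<not> Y \<subseteq> closure (L \<union> C)"
    if D: "openin (top_of_set (Y - L)) D" "D \<noteq> {}" and C: "C = (Y - L) - D" for C D
  proof
    assume sub: "Y \<subseteq> closure (L \<union> C)"
    have "D \<subseteq> Y - L" using D(1) by (rule openin_imp_subset)
    then have "L \<union> C = Y - D" using C L(1) by auto
    moreover have "openin (top_of_set Y) D" using D(1) opY by (rule openin_trans)
    ultimately have "closedin (top_of_set Y) (L \<union> C)" by (simp add: closedin_diff)
    then obtain T where T: "closed T" "L \<union> C = Y \<inter> T" by (auto simp: closedin_closed)
    then have "closure (L \<union> C) \<subseteq> T" by (intro closure_minimal) auto
    then have "L \<union> C = Y" using sub T(2) by blast
    then show False using \<open>L \<union> C = Y - D\<close> D(2) \<open>D \<subseteq> Y - L\<close> by blast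
  qed
  have "Y \<subseteq> closure ((L \<union> A) \<union> (L \<union> B))"
    using AB(3) closure_subset[of "(L \<union> A) \<union> (L \<union> B)"] by blast
  moreover have "L \<union> A \<subseteq> Y" "L \<union> B \<subseteq> Y" using AB(3) L(1) by auto
  ultimately have "Y \<subseteq> closure (L \<union> A) \<or> Y \<subseteq> closure (L \<union> B)"
    using ind cA cB unfolding dense_indecomposable_def by blast
  then show ?thesis using miss[OF op(2) AB(6) eq(1)] miss[OF op(1) AB(5) eq(2)] by blast
qed

section \<open>Boundary bumping\<close>

text \<open>
  Apply boundary bumping to \<open>M - U\<close>: the component of \<open>p\<close> in this proper closed subset of \<open>M\<close>
  contains a point of its frontier.
\<close>

lemma continuum_reaching_closure_of_open:
  fixes M :: "'a::metric_space set"
  assumes M: "compact M" "connected M" and p: "p \<in> M" "p \<notin> U" and U: "open U" "M \<inter> U \<noteq> {}"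
  obtains C where "compact C" "connected C" "p \<in> C" "C \<subseteq> M - U" "C \<inter> closure U \<noteq> {}"
proof -
  let ?T = "top_of_set M"
  define C where "C = connected_component_of_set (subtopology ?T (M - U)) p"
  have top: "topspace (subtopology ?T (M - U)) = M - U" by auto
  have C: "C \<in> connected_components_of (subtopology ?T (M - U))"
    unfolding C_def connected_components_of_def using p by auto
  have clo: "closedin ?T (M - U)"
    using U(1) by (simp add: closedin_diff openin_open_Int Diff_Int_distrib2 closed_Compl Diff_eq closedin_closed_Int)
  have "C \<inter> ?T frontier_of (M - U) \<noteq> {}"
  proof (rule boundary_bumping_theorem_closed[OF _ _ _ clo _ C])
    show "connected_space ?T" using M(2) by (metis connectedin_def connectedin_iff_connected)
    show "compact_space ?T" using M by (simp add: compact_space_subtopology)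
    show "Hausdorff_space ?T" by (simp add: Hausdorff_space_subtopology)
    show "M - U \<noteq> topspace ?T" using U by auto
  qed
  then obtain z where z: "z \<in> C" "z \<in> ?T frontier_of (M - U)" by blast
  show thesis
  proof
    have "closedin (subtopology ?T (M - U)) C" using C by (rule closedin_connected_components_of)
    then have "closedin ?T C" using clo closedin_trans_full by blast
    then show "compact C" using M(1) closedin_compact by blast
    have "connectedin (subtopology ?T (M - U)) C" using C by (rule connectedin_connected_components_of)
    then show "connected C" by (simp add: connectedin_subtopology)
    show "p \<in> C" unfolding C_def using p by (simp add: connected_component_of_refl)
    show "C \<subseteq> M - U" using connected_components_of_subset[OF C] top by simp
    show "C \<inter> closure U \<noteq> {}"
    proof -
      have "z \<in> ?T closure_of (M - (M - U))"
        using z(2) by (metis IntD2 frontier_of_closures topspace_euclidean_subtopology)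
      also have "\<dots> \<subseteq> closure U"
        by (metis Diff_Diff_Int closure_mono closure_of_subtopology_subset euclidean_closure_of inf_le2 order_trans)
      finally show ?thesis using z(1) by blast
    qed
  qed
qed

section \<open>Continua in the complement of a continuum\<close>

text \<open>
  The set \<open>B\<close> is a union of continuum components of \<open>Y - L\<close>. For \<open>x \<in> B\<close> take a continuum \<open>M\<close> from
  \<open>x\<close> to \<open>L\<close> and let \<open>P\<close> be the union of the continua in \<open>M - L\<close> through \<open>x\<close>. Were \<open>P\<close> at a
  positive distance from \<open>L\<close>, boundary bumping in \<open>M\<close> would give such a continuum coming closer to
  \<open>L\<close>. So \<open>P\<close> accumulates at a point of \<open>L\<close>; adding this point keeps it connected and attaches
  \<open>x\<close> to \<open>L\<close>.
\<close>

lemma connected_Un_saturated: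
  fixes Y :: "'a::metric_space set"
  assumes joined: "\<And>x y. x \<in> Y \<Longrightarrow> y \<in> Y \<Longrightarrow> \<exists>M. compact M \<and> connected M \<and> M \<subseteq> Y \<and> x \<in> M \<and> y \<in> M"
    and L: "L \<subseteq> Y" "compact L" "connected L" "L \<noteq> {}"
    and B: "B \<subseteq> Y - L"
    and sat: "\<And>x C. \<lbrakk>x \<in> B; x \<in> C; compact C; connected C; C \<subseteq> Y - L\<rbrakk> \<Longrightarrow> C \<subseteq> B"
  shows "connected (L \<union> B)"
proof -
  define \<T> where "\<T> = {T. connected T \<and> T \<subseteq> L \<union> B \<and> L \<inter> T \<noteq> {}}"
  have "\<exists>T\<in>\<T>. x \<in> T" if x: "x \<in> B" for x
  proof -
    obtain l where l: "l \<in> L" using L by blast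
    obtain M where M: "compact M" "connected M" "M \<subseteq> Y" "x \<in> M" "l \<in> M"
      using joined[of x l] x B L l by blast
    define P where "P = \<Union>{C. compact C \<and> connected C \<and> x \<in> C \<and> C \<subseteq> M - L}"
    have "connected P"
      unfolding P_def by (rule connected_Union) auto
    have "P \<subseteq> B"
      unfolding P_def using sat[OF x] M(3) by blast
    have "{x} \<subseteq> M - L" using M B x by auto
    then have xP: "x \<in> P"
      unfolding P_def by (intro UnionI[of "{x}"]) auto
    have "P \<subseteq> M" unfolding P_def by blast
    have "compact (closure P)"
    proof -
      have "closure P \<subseteq> M"
        using \<open>P \<subseteq> M\<close> M(1) by (intro closure_minimal compact_imp_closed)
      then show ?thesis
        using compact_Int_closed[OF M(1) closed_closure[of P]] by (simp add: Int_absorb1)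
    qed
    have "closure P \<inter> L \<noteq> {}"
    proof
      assume "closure P \<inter> L = {}"
      have "closure P \<noteq> {}" using xP closure_subset[of P] by blast
      moreover have "continuous_on (closure P) (\<lambda>y. infdist y L)"
        by (intro continuous_intros)
      ultimately obtain w where w: "w \<in> closure P" "\<And>y. y \<in> closure P \<Longrightarrow> infdist w L \<le> infdist y L"
        using continuous_attains_inf[OF \<open>compact (closure P)\<close>] by blast
      define e where "e = infdist w L"
      have "infdist w L \<noteq> 0"
        using w(1) \<open>closure P \<inter> L = {}\<close> in_closed_iff_infdist_zero[OF compact_imp_closed[OF L(2)] L(4)] by blast
      then have e: "e > 0" unfolding e_def using infdist_nonneg[of w L] by linarith
      \<comment> \<open>A continuum in \<open>M - U\<close> through \<open>x\<close> avoids \<open>L\<close>, so it lies in \<open>P\<close>, at distance at least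
        \<open>e\<close> from \<open>L\<close>. Bumping into \<open>closure U\<close> contradicts this.\<close>
      define U where "U = {y. infdist y L < e/2}"
      have "open U" unfolding U_def
        by (intro open_Collect_less continuous_intros)
      have far: "e \<le> infdist y L" if "y \<in> closure P" for y
        using w(2)[OF that] unfolding e_def .
      have "x \<notin> U" using far[of x] xP closure_subset[of P] e(1) unfolding U_def by force
      moreover have "l \<in> M \<inter> U" using M l e unfolding U_def by simp
      ultimately obtain C where C: "compact C" "connected C" "x \<in> C" "C \<subseteq> M - U" "C \<inter> closure U \<noteq> {}"
        using continuum_reaching_closure_of_open[OF M(1,2) M(4) _ \<open>open U\<close>] by blast
      have "L \<subseteq> U" unfolding U_def using e by auto
      then have "C \<subseteq> P" unfolding P_def using C by blast
      obtain z where z: "z \<in> C" "z \<in> closure U" using C by blast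
      have "closed {y. infdist y L \<le> e/2}"
        by (intro closed_Collect_le continuous_intros)
      then have "closure U \<subseteq> {y. infdist y L \<le> e/2}"
        unfolding U_def by (intro closure_minimal) auto
      then have "infdist z L \<le> e/2" using z by blast
      moreover have "e \<le> infdist z L" using far z \<open>C \<subseteq> P\<close> closure_subset by blast
      ultimately show False using e(1) by linarith
    qed
    then obtain z where z: "z \<in> closure P" "z \<in> L" by blast
    have "connected (insert z P)"
      by (rule connected_intermediate_closure[OF \<open>connected P\<close>]) (use z closure_subset in auto)
    then have "insert z P \<in> \<T>"
      unfolding \<T>_def using z \<open>P \<subseteq> B\<close> by blast
    then show ?thesis using xP by blast
  qed
  then have "B \<subseteq> \<Union>\<T>" by blast
  moreover have "\<Union>\<T> \<subseteq> L \<union> B" unfolding \<T>_def by blast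
  ultimately have "L \<union> B = L \<union> \<Union>\<T>" by blast
  moreover have "connected (L \<union> \<Union>\<T>)"
    by (rule connected_Un_UN) (use L in \<open>auto simp: \<T>_def\<close>)
  ultimately show ?thesis by simp
qed

text \<open>
  In the proof \<open>P x\<close> is the continuum component of \<open>x\<close> in \<open>Y - L\<close>, and \<open>D \<V>\<close> is the union of the
  components that meet every member of \<open>\<V>\<close>. Only the density of \<open>L \<union> D \<V>\<close>, and not just
  \<open>D \<V> \<noteq> {}\<close>, can be carried through the induction. A component meeting all the open sets contains
  finitely many continua through \<open>x\<close>, one for each of the sets, and their union is the required
  continuum. Single points count as continua here.
\<close>

lemma continuum_in_complement_meeting_opens:
  fixes Y :: "'a::metric_space set"
  assumes ind: "dense_indecomposable Y"
    and joined: "\<And>x y. x \<in> Y \<Longrightarrow> y \<in> Y \<Longrightarrow> \<exists>M. compact M \<and> connected M \<and> M \<subseteq> Y \<and> x \<in> M \<and> y \<in> M"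
    and L: "L \<subseteq> Y" "compact L" "connected L" "L \<noteq> {}" "L \<noteq> Y"
    and \<U>: "finite \<U>" "\<And>U. U \<in> \<U> \<Longrightarrow> open U \<and> Y \<inter> U \<noteq> {}"
  obtains K where "compact K" "connected K" "K \<subseteq> Y - L" "\<And>U. U \<in> \<U> \<Longrightarrow> K \<inter> U \<noteq> {}"
proof -
  have "closed L" using L by (simp add: compact_imp_closed)
  have "connected Y"
    unfolding connected_iff_connected_component
  proof (intro ballI)
    fix x y assume "x \<in> Y" "y \<in> Y"
    from joined[OF this] show "connected_component Y x y" unfolding connected_component_def by blast
  qed
  have thick: "Y \<subseteq> closure (Y - L)"
    by (rule dense_indecomposable_dense_complement[OF ind \<open>connected Y\<close> L(1) \<open>closed L\<close> L(3,5)])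
  define \<D> where "\<D> = {C. compact C \<and> connected C \<and> C \<subseteq> Y - L}"
  define P where "P x = \<Union>{C \<in> \<D>. x \<in> C}" for x
  define D where "D \<V> = {x \<in> Y - L. \<forall>U\<in>\<V>. P x \<inter> U \<noteq> {}}" for \<V>
  have P_sub: "P x \<subseteq> P y" if "C \<in> \<D>" "x \<in> C" "y \<in> C" for x y C
  proof
    fix z assume "z \<in> P x"
    then obtain E where E: "E \<in> \<D>" "x \<in> E" "z \<in> E" unfolding P_def by blast
    have "connected (C \<union> E)" using that E by (intro connected_Un) (auto simp: \<D>_def)
    then have "C \<union> E \<in> \<D>" using that E unfolding \<D>_def by (simp add: compact_Un)
    then show "z \<in> P y" unfolding P_def using that E by blast
  qed
  have P_eq: "P x = P y" if "C \<in> \<D>" "x \<in> C" "y \<in> C" for x y C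
    using P_sub that by blast
  have connD: "connected (L \<union> {x \<in> Y - L. Q (P x)})" for Q
  proof (rule connected_Un_saturated[OF joined L(1-4)])
    fix x C assume x: "x \<in> {x \<in> Y - L. Q (P x)}" "x \<in> C" and C: "compact C" "connected C" "C \<subseteq> Y - L"
    then have "C \<in> \<D>" unfolding \<D>_def by blast
    show "C \<subseteq> {x \<in> Y - L. Q (P x)}"
    proof
      fix y assume "y \<in> C"
      then have "P x = P y" using P_eq[OF \<open>C \<in> \<D>\<close> x(2)] by blast
      then show "y \<in> {x \<in> Y - L. Q (P x)}" using x(1) \<open>y \<in> C\<close> C(3) by auto
    qed
  qed auto
  have "Y \<subseteq> closure (L \<union> D \<U>)"
    using \<U>
  proof (induction rule: finite_induct)
    case empty
    have "Y - L \<subseteq> L \<union> D {}" unfolding D_def by blast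
    then show ?case using thick closure_mono by blast
  next
    case (insert U \<V>)
    let ?B = "{x \<in> Y - L. (\<forall>V\<in>\<V>. P x \<inter> V \<noteq> {}) \<and> P x \<inter> U = {}}"
    have U: "open U" "Y \<inter> U \<noteq> {}" using insert.prems by auto
    have "L \<union> D \<V> = (L \<union> D (insert U \<V>)) \<union> (L \<union> ?B)"
      unfolding D_def by blast
    then have "Y \<subseteq> closure ((L \<union> D (insert U \<V>)) \<union> (L \<union> ?B))"
      using insert by simp
    moreover have "connected (L \<union> D (insert U \<V>))"
      unfolding D_def by (rule connD[of "\<lambda>S. \<forall>W\<in>insert U \<V>. S \<inter> W \<noteq> {}"])
    moreover have "connected (L \<union> ?B)"
      by (rule connD[of "\<lambda>S. (\<forall>V\<in>\<V>. S \<inter> V \<noteq> {}) \<and> S \<inter> U = {}"])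
    moreover have "L \<union> D (insert U \<V>) \<subseteq> Y" "L \<union> ?B \<subseteq> Y"
      unfolding D_def using L(1) by auto
    ultimately have "Y \<subseteq> closure (L \<union> D (insert U \<V>)) \<or> Y \<subseteq> closure (L \<union> ?B)"
      using ind unfolding dense_indecomposable_def by blast
    moreover have "\<not> Y \<subseteq> closure (L \<union> ?B)"
    proof
      assume sub: "Y \<subseteq> closure (L \<union> ?B)"
      have "U \<inter> closure (Y - L) \<noteq> {}" using U thick by blast
      then obtain u where u: "u \<in> U" "u \<in> Y - L"
        using open_Int_closure_eq_empty[OF U(1)] by blast
      have "open (U - L)" using U(1) \<open>closed L\<close> by (rule open_Diff)
      moreover have "(U - L) \<inter> closure (L \<union> ?B) \<noteq> {}" using u sub by blast
      ultimately have "(U - L) \<inter> (L \<union> ?B) \<noteq> {}" using open_Int_closure_eq_empty by blast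
      then obtain x where x: "x \<in> U" "x \<in> Y - L" "P x \<inter> U = {}" by blast
      have "{x} \<in> \<D>" using x unfolding \<D>_def by simp
      then have "x \<in> P x" unfolding P_def by blast
      then show False using x by blast
    qed
    ultimately show ?case by blast
  qed
  moreover have "\<not> Y \<subseteq> closure L" using L \<open>closed L\<close> by auto
  ultimately have "D \<U> \<noteq> {}" by fastforce
  then obtain x where x: "x \<in> D \<U>" by blast
  then have "\<forall>U\<in>\<U>. \<exists>C. C \<in> \<D> \<and> x \<in> C \<and> C \<inter> U \<noteq> {}"
    unfolding D_def P_def by blast
  then obtain C where C: "\<And>U. U \<in> \<U> \<Longrightarrow> C U \<in> \<D> \<and> x \<in> C U \<and> C U \<inter> U \<noteq> {}"
    by metis
  define K where "K = {x} \<union> \<Union>(C ` \<U>)"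
  show thesis
  proof
    show "compact K" unfolding K_def using C \<U>(1)
      by (intro compact_Un compact_UN) (auto simp: \<D>_def)
    show "connected K" unfolding K_def
      by (rule connected_Un_UN) (use C in \<open>auto simp: \<D>_def\<close>)
    show "K \<subseteq> Y - L" unfolding K_def using x C by (auto simp: \<D>_def D_def)
    show "K \<inter> U \<noteq> {}" if "U \<in> \<U>" for U using C[OF that] that unfolding K_def by blast
  qed
qed

section \<open>Disjoint continua by recursion\<close>

text \<open>
  The recursion constructs pairs \<open>(L, K)\<close>, where \<open>L\<close> contains all continua chosen so far and \<open>K\<close> is
  the last of them. The proper inclusion in the assumption \<open>joined\<close> makes it possible to enlarge
  \<open>L\<close>: by indecomposability a union of two proper continua with a common point is proper.
\<close>

lemma disjoint_continua_meeting_opens: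
  fixes Y :: "'a::metric_space set" and U :: "nat \<Rightarrow> 'a set"
  assumes ind: "dense_indecomposable Y" and nd: "nondegenerate Y"
    and joined: "\<And>x y. x \<in> Y \<Longrightarrow> y \<in> Y \<Longrightarrow> \<exists>M. compact M \<and> connected M \<and> M \<subset> Y \<and> x \<in> M \<and> y \<in> M"
    and U: "\<And>n. open (U n)" "\<And>n. Y \<inter> U n \<noteq> {}"
  shows "\<exists>K. (\<forall>n. continuum (K n) \<and> K n \<subset> Y) \<and> disjoint_family K \<and>
    (\<forall>n. \<forall>i\<le>n. K n \<inter> U i \<noteq> {})"
proof -
  define \<L> where "\<L> = {L. compact L \<and> connected L \<and> L \<noteq> {} \<and> L \<subset> Y}"
  have Un: "\<exists>E\<in>\<L>. A \<union> B \<subseteq> E" if A: "A \<in> \<L>" and B: "B \<in> \<L>" for A B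
  proof -
    obtain a b where ab: "a \<in> A" "b \<in> B" using A B unfolding \<L>_def by blast
    then have "a \<in> Y" "b \<in> Y" using A B unfolding \<L>_def by auto
    then obtain M where M: "compact M" "connected M" "M \<subset> Y" "a \<in> M" "b \<in> M"
      using joined by blast
    have *: "C \<union> E \<in> \<L>" if "C \<in> \<L>" "E \<in> \<L>" "C \<inter> E \<noteq> {}" for C E
    proof -
      have "C \<union> E \<noteq> Y"
        by (rule dense_indecomposable_closed_Un[OF ind]) (use that in \<open>auto simp: \<L>_def compact_imp_closed\<close>)
      moreover have "connected (C \<union> E)" using that by (intro connected_Un) (auto simp: \<L>_def)
      ultimately show ?thesis using that unfolding \<L>_def by (auto intro: compact_Un)
    qed
    have "M \<in> \<L>" using M unfolding \<L>_def by blast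
    then have "A \<union> M \<union> B \<in> \<L>" using A B ab M by (intro *) auto
    then show ?thesis by (intro bexI[of _ "A \<union> M \<union> B"]) auto
  qed
  obtain a b where ab: "a \<in> Y" "b \<in> Y" "a \<noteq> b" using nd unfolding nondegenerate_def by blast
  \<comment> \<open>Continua that meet both \<open>V\<close> and \<open>W\<close> have more than one point.\<close>
  obtain V W where VW: "open V" "open W" "a \<in> V" "b \<in> W" "V \<inter> W = {}"
    using hausdorff[OF ab(3)] by blast
  have next_K: "\<exists>K. continuum K \<and> K \<in> \<L> \<and> K \<inter> L = {} \<and> (\<forall>i\<le>n. K \<inter> U i \<noteq> {})"
    if L: "L \<in> \<L>" for L n
  proof -
    have fin: "finite (insert V (insert W (U ` {..n})))" by simp
    have opn: "open T \<and> Y \<inter> T \<noteq> {}" if "T \<in> insert V (insert W (U ` {..n}))" for T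
      using that U VW ab by auto
    have L': "L \<subseteq> Y" "compact L" "connected L" "L \<noteq> {}" "L \<noteq> Y" using L unfolding \<L>_def by auto
    have joined': "\<exists>M. compact M \<and> connected M \<and> M \<subseteq> Y \<and> x \<in> M \<and> y \<in> M" if "x \<in> Y" "y \<in> Y" for x y
      using joined[OF that] by blast
    obtain K where K: "compact K" "connected K" "K \<subseteq> Y - L"
        "\<And>T. T \<in> insert V (insert W (U ` {..n})) \<Longrightarrow> K \<inter> T \<noteq> {}"
      using continuum_in_complement_meeting_opens[OF ind joined' L' fin opn] by blast
    have "K \<inter> V \<noteq> {}" "K \<inter> W \<noteq> {}" using K(4) by simp_all
    then obtain v w where "v \<in> K" "v \<in> V" "w \<in> K" "w \<in> W" by blast
    moreover from this have "v \<noteq> w" using VW(5) by blast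
    ultimately have "nondegenerate K" unfolding nondegenerate_def by blast
    moreover have "K \<in> \<L>" using K L'(1,4) \<open>K \<inter> V \<noteq> {}\<close> unfolding \<L>_def by blast
    moreover have "\<forall>i\<le>n. K \<inter> U i \<noteq> {}" using K(4) by simp
    ultimately show ?thesis using K(1-3) unfolding continuum_def by (intro exI[of _ K]) blast
  qed
  define P where "P n = (\<lambda>(L, K). L \<in> \<L> \<and> continuum K \<and> K \<in> \<L> \<and> K \<subseteq> L \<and> (\<forall>i\<le>n. K \<inter> U i \<noteq> {}))" for n :: nat
  define Q where "Q = (\<lambda>(L :: 'a set, K :: 'a set) (L' :: 'a set, K' :: 'a set). L \<subseteq> L' \<and> K' \<inter> L = {})"
  have "\<exists>f. \<forall>n. P n (f n) \<and> Q (f n) (f (Suc n))"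
  proof (rule dependent_nat_choice)
    have "{a} \<in> \<L>" using ab unfolding \<L>_def by auto
    from next_K[OF this, of 0] obtain K where "continuum K" "K \<in> \<L>" "\<forall>i\<le>0. K \<inter> U i \<noteq> {}"
      by blast
    then show "\<exists>x. P 0 x" unfolding P_def by (intro exI[of _ "(K, K)"]) auto
  next
    fix x n assume P: "P n x"
    obtain L K where x: "x = (L, K)" by (cases x)
    then have "L \<in> \<L>" using P unfolding P_def by simp
    from next_K[OF this, of "Suc n"]
    obtain K' where K': "continuum K'" "K' \<in> \<L>" "K' \<inter> L = {}" "\<forall>i\<le>Suc n. K' \<inter> U i \<noteq> {}"
      by blast
    obtain L' where "L' \<in> \<L>" "L \<union> K' \<subseteq> L'" using Un[OF \<open>L \<in> \<L>\<close> K'(2)] by blast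
    then show "\<exists>y. P (Suc n) y \<and> Q x y"
      unfolding P_def Q_def x using K' by (intro exI[of _ "(L', K')"]) auto
  qed
  then obtain f where f: "\<And>n. P n (f n)" "\<And>n. Q (f n) (f (Suc n))" by blast
  define L K where "L n = fst (f n)" and "K n = snd (f n)" for n
  have P: "continuum (K n)" "K n \<in> \<L>" "K n \<subseteq> L n" "\<forall>i\<le>n. K n \<inter> U i \<noteq> {}" for n
    using f(1)[of n] unfolding P_def L_def K_def by (auto simp: case_prod_beta)
  have Q: "L n \<subseteq> L (Suc n)" "K (Suc n) \<inter> L n = {}" for n
    using f(2)[of n] unfolding Q_def L_def K_def by (auto simp: case_prod_beta)
  have disj: "K m \<inter> K n = {}" if "m < n" for m n
  proof -
    obtain k where k: "n = Suc k" "m \<le> k" using \<open>m < n\<close> by (cases n) auto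
    have "L m \<subseteq> L k" using Q(1) k(2) by (rule lift_Suc_mono_le)
    then show ?thesis using P(3)[of m] Q(2)[of k] k(1) by blast
  qed
  have "disjoint_family K"
    unfolding disjoint_family_on_def using disj by (metis Int_commute nat_neq_iff)
  moreover have "K n \<subset> Y" for n using P(2)[of n] unfolding \<L>_def by blast
  ultimately show ?thesis using P(1,4) by blast
qed

section \<open>Composants\<close>

definition composant :: "'a::metric_space set \<Rightarrow> 'a \<Rightarrow> 'a set" where
  "composant X p = \<Union>{C. compact C \<and> connected C \<and> C \<subset> X \<and> p \<in> C}"

text \<open>
  A continuum from \<open>p\<close> to \<open>x\<close> contains, by boundary bumping, a continuum through \<open>p\<close> that stays
  outside a small ball around \<open>x\<close>, hence is proper, but reaches the closure of this ball.
\<close>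

lemma composant_dense:
  assumes semi: "semicontinuum X" and "nondegenerate X" and p: "p \<in> X"
  shows "X \<subseteq> closure (composant X p)"
proof
  fix x assume x: "x \<in> X"
  show "x \<in> closure (composant X p)"
  proof (cases "x = p")
    case True
    have "{p} \<subset> X" using p \<open>nondegenerate X\<close> unfolding nondegenerate_def by blast
    then have "p \<in> composant X p" unfolding composant_def by (intro UnionI[of "{p}"]) auto
    then show ?thesis using True closure_subset by blast
  next
    case False
    show ?thesis
      unfolding closure_approachable
    proof (intro allI impI)
      fix e :: real assume "e > 0"
      define r where "r = min (e/2) (dist p x / 2)"
      have "0 < dist p x" using False by simp
      then have r: "r > 0" "r < e" "r < dist p x"
        using \<open>e > 0\<close> \<open>0 < dist p x\<close> unfolding r_def by linarith+
      obtain M where M: "compact M" "connected M" "M \<subseteq> X" "p \<in> M" "x \<in> M"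
        using semi p x False unfolding semicontinuum_def continuum_def by blast
      have "p \<notin> ball x r" "M \<inter> ball x r \<noteq> {}"
        using r M by (auto simp: dist_commute)
      then obtain C where C: "compact C" "connected C" "p \<in> C" "C \<subseteq> M - ball x r" "C \<inter> closure (ball x r) \<noteq> {}"
        using continuum_reaching_closure_of_open[OF M(1,2,4) \<open>p \<notin> ball x r\<close> open_ball \<open>M \<inter> ball x r \<noteq> {}\<close>] by metis
      have "x \<notin> C" using C(4) r by auto
      then have "C \<subset> X" using C(4) M(3) x by blast
      then have "C \<subseteq> composant X p" unfolding composant_def using C by blast
      obtain z where z: "z \<in> C" "z \<in> closure (ball x r)" using C by blast
      then have "dist x z \<le> r" using closure_minimal[OF ball_subset_cball closed_cball] by (metis mem_cball subsetD)
      then show "\<exists>y\<in>composant X p. dist y x < e"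
        using z \<open>C \<subseteq> composant X p\<close> r by (intro bexI[of _ z]) (auto simp: dist_commute)
    qed
  qed
qed

lemma composant_subset: "composant X p \<subseteq> X"
  unfolding composant_def by blast

text \<open>
  The union of two proper continua through \<open>p\<close> is proper in \<open>X\<close> by indecomposability. It cannot be
  the whole composant either, since it is closed and the composant is dense.
\<close>

lemma composant_joined:
  assumes ind: "dense_indecomposable X" and dense: "X \<subseteq> closure (composant X p)"
    and x: "x \<in> composant X p" and y: "y \<in> composant X p"
  shows "\<exists>M. compact M \<and> connected M \<and> M \<subset> composant X p \<and> x \<in> M \<and> y \<in> M"
proof -
  obtain C where C: "compact C" "connected C" "C \<subset> X" "p \<in> C" "x \<in> C"
    using x unfolding composant_def by blast
  obtain D where D: "compact D" "connected D" "D \<subset> X" "p \<in> D" "y \<in> D"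
    using y unfolding composant_def by blast
  have comp: "compact (C \<union> D)" using C D by (simp add: compact_Un)
  have "C \<union> D \<noteq> X"
    by (rule dense_indecomposable_closed_Un[OF ind]) (use C D in \<open>auto simp: compact_imp_closed\<close>)
  have "C \<union> D \<subseteq> composant X p"
    unfolding composant_def using C D by blast
  moreover have "C \<union> D \<noteq> composant X p"
  proof
    assume "C \<union> D = composant X p"
    then have "X \<subseteq> C \<union> D" using dense compact_imp_closed[OF comp] by simp
    then show False using \<open>C \<union> D \<noteq> X\<close> C D by blast
  qed
  moreover have "connected (C \<union> D)" using C D by (intro connected_Un) auto
  ultimately show ?thesis using comp C D by (intro exI[of _ "C \<union> D"]) blast
qed

section \<open>Convergence to the whole space\<close>

text \<open>
  The sets \<open>U n\<close> are the balls of radius \<open>1 / (k + 1)\<close> around the points of a countable dense subset.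
  They are open in the ambient space, so that they can be used for \<open>X\<close> and for its composants alike.
\<close>

lemma separable_imp_countable_family_of_opens:
  fixes X :: "'a::metric_space set"
  assumes "separable_space (top_of_set X)" "X \<noteq> {}"
  obtains U :: "nat \<Rightarrow> 'a set" where "\<And>n. open (U n)" "\<And>n. X \<inter> U n \<noteq> {}"
    "\<And>V. openin (top_of_set X) V \<Longrightarrow> V \<noteq> {} \<Longrightarrow> \<exists>n. X \<inter> U n \<subseteq> V"
proof -
  obtain C where C: "countable C" "C \<subseteq> X" "top_of_set X closure_of C = X"
    using assms(1) unfolding separable_space_def by auto
  have dense: "X \<subseteq> closure C"
    using C by (metis closure_of_subtopology_subset euclidean_closure_of)
  have "C \<noteq> {}" using dense assms(2) by auto
  define \<B> where "\<B> = (\<lambda>(c, k). ball c (inverse (real (Suc k)))) ` (C \<times> UNIV)"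
  have "countable \<B>" "\<B> \<noteq> {}" unfolding \<B>_def using C(1) \<open>C \<noteq> {}\<close> by auto
  then have range: "range (from_nat_into \<B>) = \<B>" by (simp add: range_from_nat_into)
  show thesis
  proof
    show "open (from_nat_into \<B> n)" for n
    proof -
      have "from_nat_into \<B> n \<in> \<B>" using \<open>\<B> \<noteq> {}\<close> by (rule from_nat_into)
      then show ?thesis unfolding \<B>_def by auto
    qed
    show "X \<inter> from_nat_into \<B> n \<noteq> {}" for n
    proof -
      have "from_nat_into \<B> n \<in> \<B>" using \<open>\<B> \<noteq> {}\<close> by (rule from_nat_into)
      then obtain c k where ck: "c \<in> C" "from_nat_into \<B> n = ball c (inverse (real (Suc k)))"
        unfolding \<B>_def by auto
      then have "c \<in> from_nat_into \<B> n" by simp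
      then show ?thesis using ck(1) C(2) by blast
    qed
    fix V assume V: "openin (top_of_set X) V" "V \<noteq> {}"
    then obtain T where T: "open T" "V = X \<inter> T" by (auto simp: openin_open)
    have "T \<inter> closure C \<noteq> {}" using dense T V by blast
    then obtain c where c: "c \<in> C" "c \<in> T" using open_Int_closure_eq_empty[OF T(1)] by blast
    then obtain e where e: "e > 0" "ball c e \<subseteq> T" using T(1) open_contains_ball by blast
    obtain k where k: "inverse (real (Suc k)) < e" using reals_Archimedean[OF e(1)] by blast
    have "ball c (inverse (real (Suc k))) \<in> \<B>" unfolding \<B>_def using c(1) by auto
    then obtain n where n: "from_nat_into \<B> n = ball c (inverse (real (Suc k)))"
      using range by (metis imageE)
    have "ball c (inverse (real (Suc k))) \<subseteq> T" using k e(2) by (meson less_imp_le order_trans subset_ball)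
    then show "\<exists>n. X \<inter> from_nat_into \<B> n \<subseteq> V" using n T(2) by (intro exI[of _ n]) auto
  qed
qed

lemma vietoris_converges_imp_infdist_tendsto:
  assumes conv: "vietoris_converges_to_space K X" and "x \<in> X"
  shows "(\<lambda>n. infdist x (K n)) \<longlonglongrightarrow> 0"
proof (rule LIMSEQ_I)
  fix e :: real assume "e > 0"
  have "openin (top_of_set X) (X \<inter> ball x e)" by (simp add: openin_open_Int)
  moreover have "X \<inter> ball x e \<noteq> {}" using \<open>x \<in> X\<close> \<open>e > 0\<close> by auto
  ultimately obtain N where N: "\<And>n. n \<ge> N \<Longrightarrow> K n \<inter> (X \<inter> ball x e) \<noteq> {}"
    using conv unfolding vietoris_converges_to_space_def
    by (metis finite.emptyI finite.insertI singletonD singletonI)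
  have "norm (infdist x (K n) - 0) < e" if "n \<ge> N" for n
  proof -
    obtain z where z: "z \<in> K n" "dist x z < e" using N[of n] \<open>n \<ge> N\<close> by auto
    have "infdist x (K n) \<le> dist x z" using z(1) by (rule infdist_le)
    then show ?thesis using z(2) infdist_nonneg[of x "K n"] by simp
  qed
  then show "\<exists>N. \<forall>n\<ge>N. norm (infdist x (K n) - 0) < e" by blast
qed

theorem theorem2:
  fixes X :: "'a::metric_space set"
  assumes "separable_space (top_of_set X)"
    and "indecomposable_semicontinuum X"
    and "nondegenerate X"
  shows "\<exists>K :: nat \<Rightarrow> 'a set.
           (\<forall>n. continuum (K n) \<and> K n \<subset> X) \<and>
           disjoint_family K \<and>
           vietoris_converges_to_space K X \<and>
           (\<forall>x\<in>X. (\<lambda>n. infdist x (K n)) \<longlonglongrightarrow> 0)"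
proof -
  have semi: "semicontinuum X"
    using assms(2) unfolding indecomposable_semicontinuum_def by blast
  have ind: "dense_indecomposable X"
    using assms(2) by (rule indecomposable_semicontinuum_imp_dense_indecomposable)
  obtain p q where pq: "p \<in> X" "q \<in> X" "p \<noteq> q"
    using assms(3) unfolding nondegenerate_def by blast
  define Y where "Y = composant X p"
  have dense: "X \<subseteq> closure Y" and sub: "Y \<subseteq> X"
    unfolding Y_def using composant_dense[OF semi assms(3) pq(1)] composant_subset by blast+
  have indY: "dense_indecomposable Y"
    using ind sub dense by (rule dense_indecomposable_dense_subset)
  have ndY: "nondegenerate Y"
  proof (rule ccontr)
    assume "\<not> nondegenerate Y"
    then have "Y = {} \<or> (\<exists>y. Y = {y})" unfolding nondegenerate_def by blast
    then have "closed Y" by auto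
    then have "X \<subseteq> Y" using dense by simp
    then show False using pq \<open>\<not> nondegenerate Y\<close> unfolding nondegenerate_def by blast
  qed
  have "X \<noteq> {}" using pq by blast
  with assms(1) obtain U :: "nat \<Rightarrow> 'a set"
    where U: "\<And>n. open (U n)" "\<And>n. X \<inter> U n \<noteq> {}"
      and base: "\<And>V. openin (top_of_set X) V \<Longrightarrow> V \<noteq> {} \<Longrightarrow> \<exists>n. X \<inter> U n \<subseteq> V"
    using separable_imp_countable_family_of_opens by blast
  have UY: "Y \<inter> U n \<noteq> {}" for n
  proof -
    have "U n \<inter> closure Y \<noteq> {}" using U(2)[of n] dense by blast
    then show ?thesis using open_Int_closure_eq_empty[OF U(1)] by blast
  qed
  have joined: "\<exists>M. compact M \<and> connected M \<and> M \<subset> Y \<and> x \<in> M \<and> y \<in> M"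
    if "x \<in> Y" "y \<in> Y" for x y
    using composant_joined[OF ind] dense that unfolding Y_def by blast
  have "\<exists>K. (\<forall>n. continuum (K n) \<and> K n \<subset> Y) \<and> disjoint_family K \<and>
      (\<forall>n. \<forall>i\<le>n. K n \<inter> U i \<noteq> {})"
    by (rule disjoint_continua_meeting_opens[OF indY ndY joined U(1) UY])
  then obtain K where K: "\<And>n. continuum (K n)" "\<And>n. K n \<subset> Y" "disjoint_family K"
      "\<And>n i. i \<le> n \<Longrightarrow> K n \<inter> U i \<noteq> {}"
    by metis
  have K_proper: "K n \<subset> X" for n using K(2) sub by blast
  have "vietoris_converges_to_space K X"
    unfolding vietoris_converges_to_space_def
  proof (intro conjI allI impI, goal_cases)
    case (1 n)
    have "closed (K n)" using K(1)[of n] unfolding continuum_def by (simp add: compact_imp_closed)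
    moreover have "K n \<noteq> {}" using K(4)[of 0 n] by blast
    ultimately show ?case
      unfolding hyperspace_def using K_proper[of n] by (auto intro: closed_subset)
  next
    case (2 \<U>)
    then have "\<forall>V\<in>\<U>. \<exists>n. X \<inter> U n \<subseteq> V" using base by blast
    then obtain m where m: "\<And>V. V \<in> \<U> \<Longrightarrow> X \<inter> U (m V) \<subseteq> V" by metis
    have fin: "finite (m ` \<U>)" using 2 by blast
    have "K n \<inter> V \<noteq> {}" if "n \<ge> Max (insert 0 (m ` \<U>))" "V \<in> \<U>" for n V
    proof -
      have "m V \<le> n" using that fin by (meson Max_ge finite_insert imageI insertI2 order_trans)
      show ?thesis using K(4)[OF \<open>m V \<le> n\<close>] m[OF that(2)] K_proper[of n] by blast
    qed
    then show ?case by blast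
  qed
  then show ?thesis
    using K(1,3) K_proper vietoris_converges_imp_infdist_tendsto by blast
qed

end
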